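(* Let $U$ be a smooth function of one variable. Then each curve $z=\lambda(x)$ of the $xz$ plane, where $\lambda$ belongs to the 2-parameter family $$\lambda(\rho)=\pm\int\frac{\rho A(\rho)}{\sqrt{1-\rho^2A^2(\rho)}}\,\mathrm d\rho+a_2,\qquad A(\rho)=\pm\left(2\int U(\rho)\,\frac{\mathrm d\rho}{\rho}+a_1\right),$$ with $a_1,a_2$ constants, generates a surface of revolution whose geometry-induced potential is $\sqrt{H^2-K}=U$ when rotated around the $x$ or the $z$ axis.
   Context: Surfaces are in Euclidean space $\mathbb{R}^3$ with coordinates $(x,y,z)$; $H$ and $K$ are the mean and Gaussian curvatures of the surface. The function $\lambda$ is considered for $\rho>0$ on a neighborhood where $1-\rho^2A^2(\rho)>0$. In the potential $U=U(\rho)$, the variable $\rho$ is the distance to the rotation axis. The geometry-induced potential of a particle of mass $m^*$ constrained to the surface is $-\frac{\hbar^2}{2m^*}(H^2-K)$, here described through $\sqrt{H^2-K}$.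
   Formalization: The potential is shown to equal |U|, since √(H²−K)=U fails where U<0; for the x axis the rotated curve is x=λ(z) instead of z=λ(x), because z=λ(x) around the x axis gives, for U=0, tori with H²−K≠0. *)

theory Defs
  imports "HOL-Analysis.Analysis"
begin

text \<open>On open subsets of Euclidean spaces this is the usual notion of a \<open>C\<^sup>k\<close> (respectively
  \<open>C\<^sup>\<infinity>\<close>) map: all iterated directional derivatives up to order \<open>k\<close> exist and are continuous.\<close>

primrec Ck_on :: "nat \<Rightarrow> 'a::euclidean_space set \<Rightarrow> ('a \<Rightarrow> 'b::euclidean_space) \<Rightarrow> bool" where
  "Ck_on 0 S f \<longleftrightarrow> continuous_on S f"
| "Ck_on (Suc k) S f \<longleftrightarrow>
     (\<forall>x\<in>S. f differentiable (at x)) \<and>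
     (\<forall>v. Ck_on k S (\<lambda>x. frechet_derivative f (at x) v))"

definition smooth_on :: "'a::euclidean_space set \<Rightarrow> ('a \<Rightarrow> 'b::euclidean_space) \<Rightarrow> bool" where
  "smooth_on S f \<longleftrightarrow> (\<forall>k. Ck_on k S f)"


definition dir_deriv :: "real \<times> real \<Rightarrow> (real \<times> real \<Rightarrow> real^3) \<Rightarrow> real \<times> real \<Rightarrow> real^3" where
  "dir_deriv v X p = frechet_derivative X (at p) v"

abbreviation d1 :: "(real \<times> real \<Rightarrow> real^3) \<Rightarrow> real \<times> real \<Rightarrow> real^3" where
  "d1 \<equiv> dir_deriv (1, 0)"

abbreviation d2 :: "(real \<times> real \<Rightarrow> real^3) \<Rightarrow> real \<times> real \<Rightarrow> real^3" where
  "d2 \<equiv> dir_deriv (0, 1)"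

text \<open>A smooth immersion; it need not be injective, so an angular parameter may run through all
  of the real line.\<close>

definition regular_surface_on :: "(real \<times> real) set \<Rightarrow> (real \<times> real \<Rightarrow> real^3) \<Rightarrow> bool" where
  "regular_surface_on D X \<longleftrightarrow>
     open D \<and> smooth_on D X \<and> (\<forall>p\<in>D. cross3 (d1 X p) (d2 X p) \<noteq> 0)"

definition unit_normal :: "(real \<times> real \<Rightarrow> real^3) \<Rightarrow> real \<times> real \<Rightarrow> real^3" where
  "unit_normal X p = sgn (cross3 (d1 X p) (d2 X p))"

definition mean_curvature :: "(real \<times> real \<Rightarrow> real^3) \<Rightarrow> real \<times> real \<Rightarrow> real" where
  "mean_curvature X p =
    (let E = d1 X p \<bullet> d1 X p; F = d1 X p \<bullet> d2 X p; G = d2 X p \<bullet> d2 X p;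
         N = unit_normal X p;
         e = d1 (d1 X) p \<bullet> N; f = d1 (d2 X) p \<bullet> N; g = d2 (d2 X) p \<bullet> N
     in (e * G - 2 * f * F + g * E) / (2 * (E * G - F\<^sup>2)))"

definition gauss_curvature :: "(real \<times> real \<Rightarrow> real^3) \<Rightarrow> real \<times> real \<Rightarrow> real" where
  "gauss_curvature X p =
    (let E = d1 X p \<bullet> d1 X p; F = d1 X p \<bullet> d2 X p; G = d2 X p \<bullet> d2 X p;
         N = unit_normal X p;
         e = d1 (d1 X) p \<bullet> N; f = d1 (d2 X) p \<bullet> N; g = d2 (d2 X) p \<bullet> N
     in (e * g - f\<^sup>2) / (E * G - F\<^sup>2))"

text \<open>The geometry-induced potential proper is \<open>- hbar\<^sup>2 / (2 m) * (H\<^sup>2 - K)\<close>; it is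
  described by the following quantity.\<close>

definition geometric_potential :: "(real \<times> real \<Rightarrow> real^3) \<Rightarrow> real \<times> real \<Rightarrow> real" where
  "geometric_potential X p = sqrt ((mean_curvature X p)\<^sup>2 - gauss_curvature X p)"


definition x_axis :: "(real^3) set" where "x_axis = range (\<lambda>t. vector [t, 0, 0])"
definition z_axis :: "(real^3) set" where "z_axis = range (\<lambda>t. vector [0, 0, t])"

definition rot_x :: "real \<Rightarrow> real^3 \<Rightarrow> real^3" where
  "rot_x \<theta> p = vector [p$1, cos \<theta> * p$2 - sin \<theta> * p$3, sin \<theta> * p$2 + cos \<theta> * p$3]"

definition rot_z :: "real \<Rightarrow> real^3 \<Rightarrow> real^3" where
  "rot_z \<theta> p = vector [cos \<theta> * p$1 - sin \<theta> * p$2, sin \<theta> * p$1 + cos \<theta> * p$2, p$3]"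

text \<open>\<open>\<lambda>\<close> is a function of the distance \<open>\<rho>\<close> to the rotation axis, with values along that axis.
  So the generating curve in the \<open>xz\<close> plane is \<open>z = \<lambda>(x)\<close> for rotation around the \<open>z\<close> axis, and
  the same curve with the roles of the two coordinates exchanged, \<open>x = \<lambda>(z)\<close>, for rotation
  around the \<open>x\<close> axis.  (With \<open>z = \<lambda>(x)\<close> rotated around the \<open>x\<close> axis, \<open>U = 0\<close> would yield circles
  centred off the axis, hence tori, which are not umbilic.)\<close>

definition revolve_z :: "(real \<Rightarrow> real) \<Rightarrow> real \<times> real \<Rightarrow> real^3" where
  "revolve_z lam = (\<lambda>(\<rho>, \<theta>). rot_z \<theta> (vector [\<rho>, 0, lam \<rho>]))"

definition revolve_x :: "(real \<Rightarrow> real) \<Rightarrow> real \<times> real \<Rightarrow> real^3" where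
  "revolve_x lam = (\<lambda>(\<rho>, \<theta>). rot_x \<theta> (vector [lam \<rho>, 0, \<rho>]))"


definition antiderivative_on :: "real set \<Rightarrow> (real \<Rightarrow> real) \<Rightarrow> (real \<Rightarrow> real) \<Rightarrow> bool" where
  "antiderivative_on I f F \<longleftrightarrow> (\<forall>\<rho>\<in>I. (F has_real_derivative f \<rho>) (at \<rho>))"

text \<open>The member(s) with constants \<open>a1\<close>, \<open>a2\<close> of the two-parameter family of generating functions
  on \<open>I\<close>.  Each indefinite integral stands for an arbitrary antiderivative (\<open>F\<close>, \<open>G\<close>), and the two
  signs \<open>s\<close>, \<open>t\<close> are chosen independently.\<close>

definition generating_family ::
  "(real \<Rightarrow> real) \<Rightarrow> real set \<Rightarrow> real \<Rightarrow> real \<Rightarrow> (real \<Rightarrow> real) set" where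
  "generating_family U I a1 a2 =
    {lam. \<exists>s\<in>{1, -1}. \<exists>t\<in>{1, -1}. \<exists>A F G.
        antiderivative_on I (\<lambda>\<rho>. U \<rho> / \<rho>) F \<and>
        (\<forall>\<rho>\<in>I. A \<rho> = s * (2 * F \<rho> + a1)) \<and>
        (\<forall>\<rho>\<in>I. 1 - \<rho>\<^sup>2 * (A \<rho>)\<^sup>2 > 0) \<and>
        antiderivative_on I (\<lambda>\<rho>. \<rho> * A \<rho> / sqrt (1 - \<rho>\<^sup>2 * (A \<rho>)\<^sup>2)) G \<and>
        (\<forall>\<rho>\<in>I. lam \<rho> = t * G \<rho> + a2)}"

end

theory Submission
  imports Defs
begin

text \<open>
  For the profile \<open>\<lambda>\<close> put \<open>k(\<rho>) = \<lambda>'(\<rho>) / (\<rho> sqrt (1 + \<lambda>'(\<rho>)\<^sup>2))\<close>.  This is the principal curvature of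
  the surface of revolution along the parallels, and the one along the meridians is \<open>(\<rho> k)' =
  k + \<rho> k'\<close>.  As \<open>H\<^sup>2 - K\<close> is the square of half the difference of the principal curvatures,
  \<open>sqrt (H\<^sup>2 - K) = \<bar>\<rho> k'\<bar> / 2\<close> (lemma \<open>geometric_potential_revolve\<close>), and this
  equals \<open>\<bar>U\<bar>\<close> whenever \<open>k' = \<plusminus> 2 U / \<rho>\<close>.  The function \<open>A\<close> of the family is the general
  solution of this equation, and the formula for \<open>\<lambda>\<close> solves \<open>k = \<plusminus> A\<close> for \<open>\<lambda>'\<close>: indeed
  \<open>\<lambda>'\<^sup>2 = \<rho>\<^sup>2 A\<^sup>2 / (1 - \<rho>\<^sup>2 A\<^sup>2)\<close> gives \<open>1 + \<lambda>'\<^sup>2 = 1 / (1 - \<rho>\<^sup>2 A\<^sup>2)\<close>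
  (lemma \<open>generating_family_parallel_curvature\<close>).

  Both axes are treated at once.  A surface of revolution is described in an arbitrary positively
  oriented orthonormal frame \<open>u, v, w\<close> with axis \<open>w\<close>, and its vector fields are written in the
  cylindrical frame that moves with the angle.  There differentiation, inner products and cross
  products act on the coefficients, which depend on \<open>\<rho>\<close> only; the trigonometric functions
  disappear from the curvature computation.

  Smoothness of the surface is obtained coinductively: a class of functions that is closed under
  directional derivatives consists of smooth functions (lemma \<open>smooth_on_coinduct\<close>).  For \<open>\<lambda>\<close> the
  class is an algebra of functions generated by finitely many expressions and all smooth
  functions; for the surface it is the set of fields with smooth cylindrical coefficients.
\<close>

section \<open>Smooth functions\<close>

text \<open>If differentiation in every direction stays inside the class \<open>C\<close>, it can be iterated forever.
  Members of \<open>C\<close> are considered up to equality on the open set \<open>S\<close> in the induction, because a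
  Frechet derivative is arbitrary at the points outside \<open>S\<close>.\<close>

lemma smooth_on_coinduct:
  assumes S: "open S" and f: "f \<in> C"
    and step: "\<And>g. g \<in> C \<Longrightarrow>
      \<exists>D. (\<forall>v. D v \<in> C) \<and> (\<forall>x\<in>S. (g has_derivative (\<lambda>v. D v x)) (at x))"
  shows "smooth_on S f"
proof -
  have "Ck_on k S h" if "g \<in> C" "\<forall>x\<in>S. h x = g x" for k g h
    using that
  proof (induction k arbitrary: g h)
    case 0
    then have "continuous_on S g"
      using step[OF 0(1)]
      by (metis has_derivative_at_withinI has_derivative_continuous_on)
    then show ?case
      using 0(2) by (simp cong: continuous_on_cong)
  next
    case (Suc k)
    from step[OF Suc.prems(1)] obtain D where D: "\<And>v. D v \<in> C"
      "\<And>x. x \<in> S \<Longrightarrow> (g has_derivative (\<lambda>v. D v x)) (at x)" by blast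
    have h: "(h has_derivative (\<lambda>v. D v x)) (at x)" if "x \<in> S" for x
      by (rule has_derivative_transform_within_open[OF D(2)[OF that] S that])
        (simp add: Suc.prems(2))
    then have "\<forall>x\<in>S. frechet_derivative h (at x) v = D v x" for v
      by (metis frechet_derivative_at)
    then have "Ck_on k S (\<lambda>x. frechet_derivative h (at x) v)" for v
      by (intro Suc.IH[OF D(1)])
    with h show ?case
      by (auto simp: differentiable_def)
  qed
  with f show ?thesis by (auto simp: smooth_on_def)
qed

text \<open>The point of passing to the generated algebra is that only the generators have to be
  differentiated, by the sum and product rules of first order.\<close>

inductive_set algebra_generated_by :: "(real \<Rightarrow> real) set \<Rightarrow> (real \<Rightarrow> real) set"
  for G where
  gen: "g \<in> G \<Longrightarrow> g \<in> algebra_generated_by G"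
| const: "(\<lambda>x. c) \<in> algebra_generated_by G"
| add: "\<lbrakk>f \<in> algebra_generated_by G; g \<in> algebra_generated_by G\<rbrakk>
    \<Longrightarrow> (\<lambda>x. f x + g x) \<in> algebra_generated_by G"
| mult: "\<lbrakk>f \<in> algebra_generated_by G; g \<in> algebra_generated_by G\<rbrakk>
    \<Longrightarrow> (\<lambda>x. f x * g x) \<in> algebra_generated_by G"

lemma differential_algebra_imp_smooth_on:
  assumes S: "open S"
    and G: "\<And>g. g \<in> G \<Longrightarrow>
      \<exists>g'\<in>algebra_generated_by G. \<forall>x\<in>S. (g has_real_derivative g' x) (at x)"
    and f: "f \<in> algebra_generated_by G"
  shows "smooth_on S f"
proof (rule smooth_on_coinduct[OF S f])
  fix g assume "g \<in> algebra_generated_by G"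
  then have "\<exists>g'\<in>algebra_generated_by G. \<forall>x\<in>S. (g has_real_derivative g' x) (at x)"
  proof induction
    case (gen g)
    then show ?case by (rule G)
  next
    case (const c)
    then show ?case
      by (intro bexI[of _ "\<lambda>x. 0"]) (auto intro: algebra_generated_by.const)
  next
    case (add f g)
    then obtain f' g' where
      "f' \<in> algebra_generated_by G" "\<forall>x\<in>S. (f has_real_derivative f' x) (at x)"
      "g' \<in> algebra_generated_by G" "\<forall>x\<in>S. (g has_real_derivative g' x) (at x)" by blast
    then show ?case
      by (intro bexI[of _ "\<lambda>x. f' x + g' x"])
        (auto intro!: algebra_generated_by.add derivative_intros)
  next
    case (mult f g)
    then obtain f' g' where
      "f' \<in> algebra_generated_by G" "\<forall>x\<in>S. (f has_real_derivative f' x) (at x)"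
      "g' \<in> algebra_generated_by G" "\<forall>x\<in>S. (g has_real_derivative g' x) (at x)" by blast
    with mult.hyps show ?case
      by (intro bexI[of _ "\<lambda>x. f' x * g x + g' x * f x"])
        (auto intro!: algebra_generated_by.add algebra_generated_by.mult DERIV_mult)
  qed
  then obtain g' where g': "g' \<in> algebra_generated_by G"
    "\<And>x. x \<in> S \<Longrightarrow> (g has_real_derivative g' x) (at x)" by blast
  then have "\<forall>x\<in>S. (g has_derivative (\<lambda>v. v * g' x)) (at x)"
    by (auto simp: has_field_derivative_def mult.commute[of _ "g' _"])
  then show "\<exists>D. (\<forall>v. D v \<in> algebra_generated_by G) \<and>
      (\<forall>x\<in>S. (g has_derivative (\<lambda>v. D v x)) (at x))"
    using g'(1)
    by (intro exI[of _ "\<lambda>v x. v * g' x"]) (auto intro: algebra_generated_by.intros)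
qed

lemma smooth_on_imp_smooth_derivative:
  fixes f :: "real \<Rightarrow> real"
  assumes "smooth_on S f"
  obtains f' where "smooth_on S f'" "\<And>x. x \<in> S \<Longrightarrow> (f has_real_derivative f' x) (at x)"
proof
  have *: "Ck_on (Suc k) S f" for k using assms unfolding smooth_on_def by blast
  then show "smooth_on S (\<lambda>x. frechet_derivative f (at x) 1)"
    by (simp add: smooth_on_def)
  fix x assume "x \<in> S"
  with *[of 0] have d: "(f has_derivative frechet_derivative f (at x)) (at x)"
    by (simp add: frechet_derivative_works)
  then have "frechet_derivative f (at x) = (\<lambda>v. frechet_derivative f (at x) 1 * v)"
    by (metis has_derivative_bounded_linear mult.commute mult.right_neutral
        real_scaleR_def bounded_linear.linear linear_scale)
  with d show "(f has_real_derivative frechet_derivative f (at x) 1) (at x)"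
    by (metis has_field_derivative_def)
qed

text \<open>Closure of the smooth functions under sums and products comes for free: they generate an
  algebra whose generators have their derivatives among the generators.\<close>

lemma algebra_of_smooth_imp_smooth_on:
  assumes "open S" "f \<in> algebra_generated_by {g. smooth_on S g}"
  shows "smooth_on S f"
  using assms(1) _ assms(2)
proof (rule differential_algebra_imp_smooth_on)
  fix g :: "real \<Rightarrow> real" assume "g \<in> {g. smooth_on S g}"
  then show "\<exists>g'\<in>algebra_generated_by {g. smooth_on S g}.
      \<forall>x\<in>S. (g has_real_derivative g' x) (at x)"
    by (metis algebra_generated_by.gen mem_Collect_eq smooth_on_imp_smooth_derivative)
qed

lemma smooth_on_const: "open S \<Longrightarrow> smooth_on S (\<lambda>x::real. c::real)"
  by (rule algebra_of_smooth_imp_smooth_on) (auto intro: algebra_generated_by.intros)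

lemma smooth_on_add:
  fixes f g :: "real \<Rightarrow> real"
  shows "\<lbrakk>open S; smooth_on S f; smooth_on S g\<rbrakk> \<Longrightarrow> smooth_on S (\<lambda>x. f x + g x)"
  by (rule algebra_of_smooth_imp_smooth_on) (auto intro: algebra_generated_by.intros)

lemma smooth_on_cmult:
  fixes f :: "real \<Rightarrow> real"
  shows "\<lbrakk>open S; smooth_on S f\<rbrakk> \<Longrightarrow> smooth_on S (\<lambda>x. c * f x)"
  by (rule algebra_of_smooth_imp_smooth_on) (auto intro: algebra_generated_by.intros)

lemma smooth_on_ident: "open S \<Longrightarrow> smooth_on S (\<lambda>x::real. x)"
proof (rule differential_algebra_imp_smooth_on[where G = "{\<lambda>x. x}"])
  show "(\<lambda>x. x) \<in> algebra_generated_by {\<lambda>x. x}"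
    by (simp add: algebra_generated_by.gen)
qed (auto intro!: bexI[of _ "\<lambda>x. 1"] intro: algebra_generated_by.const)

section \<open>Surfaces of revolution in a moving cylindrical frame\<close>

locale oriented_frame =
  fixes u v w :: "real^3"
  assumes unit: "u \<bullet> u = 1" "v \<bullet> v = 1" and orth: "u \<bullet> v = 0" and w: "w = cross3 u v"
begin

lemma inner_frame:
  "u \<bullet> u = 1" "v \<bullet> v = 1" "w \<bullet> w = 1"
  "u \<bullet> v = 0" "v \<bullet> u = 0" "u \<bullet> w = 0" "w \<bullet> u = 0" "v \<bullet> w = 0" "w \<bullet> v = 0"
proof -
  have "w \<bullet> w = (u \<bullet> u) * (v \<bullet> v) - (u \<bullet> v)\<^sup>2"
    unfolding w by (simp add: cross3_simps power2_eq_square)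
  then show "w \<bullet> w = 1" by (simp add: unit orth)
qed (simp_all add: unit orth w dot_cross_self inner_commute)

lemma cross_frame:
  "cross3 u v = w" "cross3 v w = u" "cross3 w u = v"
  "cross3 v u = - w" "cross3 w v = - u" "cross3 u w = - v"
proof -
  have *: "cross3 v (cross3 u v) = (v \<bullet> v) *\<^sub>R u - (u \<bullet> v) *\<^sub>R v"
    "cross3 (cross3 u v) u = (u \<bullet> u) *\<^sub>R v - (u \<bullet> v) *\<^sub>R u"
    by (simp_all add: cross3_simps forall_3)
  show "cross3 v w = u" "cross3 w u = v"
    unfolding w * by (simp_all add: unit orth)
  then show "cross3 u v = w" "cross3 v u = - w" "cross3 w v = - u" "cross3 u w = - v"
    using w cross_skew by metis+
qed

definition radial :: "real \<Rightarrow> real^3" where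
  "radial \<theta> = cos \<theta> *\<^sub>R u + sin \<theta> *\<^sub>R v"

definition angular :: "real \<Rightarrow> real^3" where
  "angular \<theta> = cos \<theta> *\<^sub>R v - sin \<theta> *\<^sub>R u"

lemma moving_frame: "oriented_frame (radial \<theta>) (angular \<theta>) w"
proof
  show "radial \<theta> \<bullet> radial \<theta> = 1" "angular \<theta> \<bullet> angular \<theta> = 1" "radial \<theta> \<bullet> angular \<theta> = 0"
    by (simp_all add: radial_def angular_def inner_frame inner_simps flip: power2_eq_square)
  have "cross3 (radial \<theta>) (angular \<theta>) = ((cos \<theta>)\<^sup>2 + (sin \<theta>)\<^sup>2) *\<^sub>R w"
    by (simp only: radial_def angular_def cross_add_left cross_mult_left cross_mult_right
        Cross3.right_diff_distrib cross_frame cross_refl)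
      (simp add: scaleR_add_left[symmetric] flip: power2_eq_square)
  then show "w = cross3 (radial \<theta>) (angular \<theta>)" by simp
qed

text \<open>The coefficients do not depend on the angle: by rotational symmetry this suffices for a surface
  of revolution, all its partial derivatives and its normal.\<close>

definition cyl :: "(real \<Rightarrow> real) \<Rightarrow> (real \<Rightarrow> real) \<Rightarrow> (real \<Rightarrow> real) \<Rightarrow> real \<times> real \<Rightarrow> real^3" where
  "cyl a b c = (\<lambda>(\<rho>, \<theta>). a \<rho> *\<^sub>R radial \<theta> + b \<rho> *\<^sub>R angular \<theta> + c \<rho> *\<^sub>R w)"

lemma inner_cyl:
  "cyl a b c p \<bullet> cyl a' b' c' p
    = a (fst p) * a' (fst p) + b (fst p) * b' (fst p) + c (fst p) * c' (fst p)"
  by (simp add: cyl_def case_prod_beta inner_add_left inner_add_right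
      oriented_frame.inner_frame[OF moving_frame])

lemma cross_cyl:
  "cross3 (cyl a b c p) (cyl a' b' c' p)
    = cyl (\<lambda>x. b x * c' x - c x * b' x) (\<lambda>x. c x * a' x - a x * c' x)
          (\<lambda>x. a x * b' x - b x * a' x) p"
  by (simp add: cyl_def case_prod_beta cross_add_left cross_add_right cross_mult_left
      cross_mult_right oriented_frame.cross_frame[OF moving_frame] algebra_simps)

text \<open>Differentiation with respect to the angle takes the radial vector to the angular one and the
  angular vector to minus the radial one, which gives the coefficients \<open>(- b, a, 0)\<close> of \<open>snd h\<close>.\<close>

lemma has_derivative_cyl:
  assumes "(a has_real_derivative a' (fst p)) (at (fst p))"
    "(b has_real_derivative b' (fst p)) (at (fst p))"
    "(c has_real_derivative c' (fst p)) (at (fst p))"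
  shows "(cyl a b c has_derivative
    (\<lambda>h. cyl (\<lambda>x. fst h * a' x + (- snd h) * b x) (\<lambda>x. fst h * b' x + snd h * a x)
      (\<lambda>x. fst h * c' x) p)) (at p)"
proof -
  have chain: "((\<lambda>q. g (fst q)) has_derivative (\<lambda>h. fst h * g' (fst p))) (at p)"
    if "(g has_real_derivative g' (fst p)) (at (fst p))"
    for g g' and p :: "real \<times> real"
    by (rule DERIV_compose_FDERIV[where f = g and g = fst and f' = "g' (fst p)",
          OF that has_derivative_fst[OF has_derivative_ident]])
  show ?thesis
    unfolding cyl_def case_prod_beta radial_def angular_def
    by (rule derivative_eq_intros chain[where g = a and g' = a', OF assms(1)]
        chain[where g = b and g' = b', OF assms(2)] chain[where g = c and g' = c', OF assms(3)]
        refl)+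
      (auto simp: algebra_simps fun_eq_iff)
qed

lemma smooth_on_cyl:
  assumes I: "open I" and "smooth_on I a" "smooth_on I b" "smooth_on I c"
  shows "smooth_on (I \<times> UNIV) (cyl a b c)"
proof (rule smooth_on_coinduct
    [where C = "{cyl a b c |a b c. smooth_on I a \<and> smooth_on I b \<and> smooth_on I c}"])
  fix g assume "g \<in> {cyl a b c |a b c. smooth_on I a \<and> smooth_on I b \<and> smooth_on I c}"
  then obtain a b c where g: "g = cyl a b c"
    and sm: "smooth_on I a" "smooth_on I b" "smooth_on I c" by blast
  from sm obtain a' b' c' where sm': "smooth_on I a'" "smooth_on I b'" "smooth_on I c'"
    and d: "\<And>x. x \<in> I \<Longrightarrow> (a has_real_derivative a' x) (at x)"
      "\<And>x. x \<in> I \<Longrightarrow> (b has_real_derivative b' x) (at x)"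
      "\<And>x. x \<in> I \<Longrightarrow> (c has_real_derivative c' x) (at x)"
    by (metis smooth_on_imp_smooth_derivative)
  show "\<exists>D. (\<forall>v. D v \<in> {cyl a b c |a b c. smooth_on I a \<and> smooth_on I b \<and> smooth_on I c}) \<and>
      (\<forall>x\<in>I \<times> UNIV. (g has_derivative (\<lambda>v. D v x)) (at x))"
  proof (intro exI conjI ballI allI)
    fix p :: "real \<times> real" assume "p \<in> I \<times> UNIV"
    then show "(g has_derivative (\<lambda>h. cyl (\<lambda>x. fst h * a' x + (- snd h) * b x)
        (\<lambda>x. fst h * b' x + snd h * a x) (\<lambda>x. fst h * c' x) p)) (at p)"
      unfolding g by (intro has_derivative_cyl d) auto
  next
    fix h :: "real \<times> real"
    have "smooth_on I (\<lambda>x. fst h * a' x + (- snd h) * b x)"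
      "smooth_on I (\<lambda>x. fst h * b' x + snd h * a x)" "smooth_on I (\<lambda>x. fst h * c' x)"
      using I sm sm' by (simp_all only: smooth_on_add smooth_on_cmult)
    then show "cyl (\<lambda>x. fst h * a' x + (- snd h) * b x)
        (\<lambda>x. fst h * b' x + snd h * a x) (\<lambda>x. fst h * c' x)
      \<in> {cyl a b c |a b c. smooth_on I a \<and> smooth_on I b \<and> smooth_on I c}"
      by blast
  qed
qed (use assms in \<open>auto intro: open_Times\<close>)

text \<open>The field \<open>X\<close> is compared with \<open>cyl a b c\<close> on the parameter domain alone, so that the lemma
  also applies to the first derivatives of a surface, which are known only there.\<close>

lemma dir_deriv_cyl:
  assumes I: "open I" and p: "p \<in> I \<times> UNIV"
    and X: "\<And>q. q \<in> I \<times> UNIV \<Longrightarrow> X q = cyl a b c q"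
    and d: "\<And>x. x \<in> I \<Longrightarrow> (a has_real_derivative a' x) (at x)"
    "\<And>x. x \<in> I \<Longrightarrow> (b has_real_derivative b' x) (at x)"
    "\<And>x. x \<in> I \<Longrightarrow> (c has_real_derivative c' x) (at x)"
  shows "d1 X p = cyl a' b' c' p" "d2 X p = cyl (\<lambda>x. - b x) a (\<lambda>_. 0) p"
proof -
  have S: "open (I \<times> (UNIV :: real set))" using I by (simp add: open_Times)
  have r: "fst p \<in> I" using p by auto
  have "(X has_derivative (\<lambda>h. cyl (\<lambda>x. fst h * a' x + (- snd h) * b x)
      (\<lambda>x. fst h * b' x + snd h * a x) (\<lambda>x. fst h * c' x) p)) (at p)"
    by (rule has_derivative_transform_within_open[OF has_derivative_cyl[where a' = a' and b' = b'
            and c' = c', OF d(1)[OF r] d(2)[OF r] d(3)[OF r]] S p X[symmetric]])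
  note D = frechet_derivative_at[OF this, symmetric]
  show "d1 X p = cyl a' b' c' p" "d2 X p = cyl (\<lambda>x. - b x) a (\<lambda>_. 0) p"
    unfolding dir_deriv_def D by simp_all
qed

definition revolve :: "(real \<Rightarrow> real) \<Rightarrow> real \<times> real \<Rightarrow> real^3" where
  "revolve l = cyl (\<lambda>\<rho>. \<rho>) (\<lambda>_. 0) l"

lemma dir_deriv_revolve:
  assumes I: "open I" and p: "p \<in> I \<times> UNIV"
    and l: "\<And>x. x \<in> I \<Longrightarrow> (l has_real_derivative l' x) (at x)"
  shows "d1 (revolve l) p = cyl (\<lambda>_. 1) (\<lambda>_. 0) l' p"
    "d2 (revolve l) p = cyl (\<lambda>_. 0) (\<lambda>\<rho>. \<rho>) (\<lambda>_. 0) p"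
proof -
  show "d1 (revolve l) p = cyl (\<lambda>_. 1) (\<lambda>_. 0) l' p"
    unfolding revolve_def by (rule dir_deriv_cyl(1)[OF I p refl DERIV_ident DERIV_const l])
  have "d2 (revolve l) p = cyl (\<lambda>x. - 0) (\<lambda>\<rho>. \<rho>) (\<lambda>_. 0) p"
    unfolding revolve_def by (rule dir_deriv_cyl(2)[OF I p refl DERIV_ident DERIV_const l])
  then show "d2 (revolve l) p = cyl (\<lambda>_. 0) (\<lambda>\<rho>. \<rho>) (\<lambda>_. 0) p" by simp
qed

lemma regular_surface_revolve:
  assumes I: "open I" "I \<subseteq> {0<..}" and l: "smooth_on I l"
  shows "regular_surface_on (I \<times> UNIV) (revolve l)"
  unfolding regular_surface_on_def
proof (intro conjI ballI)
  show "open (I \<times> (UNIV :: real set))" using I by (simp add: open_Times)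
  show "smooth_on (I \<times> UNIV) (revolve l)"
    unfolding revolve_def by (intro smooth_on_cyl smooth_on_ident smooth_on_const I l)
  fix p :: "real \<times> real" assume p: "p \<in> I \<times> UNIV"
  obtain l' where l': "\<And>x. x \<in> I \<Longrightarrow> (l has_real_derivative l' x) (at x)"
    using smooth_on_imp_smooth_derivative[OF l] by blast
  let ?n = "cross3 (d1 (revolve l) p) (d2 (revolve l) p)"
  have "?n \<bullet> ?n = (fst p)\<^sup>2 * (1 + (l' (fst p))\<^sup>2)"
    by (simp add: dir_deriv_revolve[OF I(1) p l'] cross_cyl inner_cyl algebra_simps
        power2_eq_square)
  moreover have "fst p > 0" "1 + (l' (fst p))\<^sup>2 > 0"
    using p I(2) by (auto intro: add_pos_nonneg)
  ultimately have "?n \<bullet> ?n > 0" by simp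
  then show "?n \<noteq> 0" by (metis inner_zero_left less_irrefl)
qed

text \<open>The function differentiated in the last hypothesis is the principal curvature \<open>k\<close> along the
  parallels; the other principal curvature is \<open>k + \<rho> k'\<close>.  Half of their difference, up
  to sign, is the potential.  In the proof \<open>m\<close> and \<open>n\<close> are the first two derivatives of the profile at \<open>r\<close>, and the
  principal curvatures appear as \<open>m / (r W)\<close> and \<open>n / W\<^sup>3\<close>.\<close>

lemma geometric_potential_revolve:
  assumes I: "open I" "I \<subseteq> {0<..}" and p: "p \<in> I \<times> UNIV"
    and l: "\<And>x. x \<in> I \<Longrightarrow> (l has_real_derivative l' x) (at x)"
    and l': "\<And>x. x \<in> I \<Longrightarrow> (l' has_real_derivative l'' x) (at x)"
    and k: "((\<lambda>x. l' x / (x * sqrt (1 + (l' x)\<^sup>2))) has_real_derivative k') (at (fst p))"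
  shows "geometric_potential (revolve l) p = \<bar>fst p * k'\<bar> / 2"
proof -
  define r where "r = fst p"
  define m where "m = l' r"
  define n where "n = l'' r"
  define W where "W = sqrt (1 + m\<^sup>2)"
  have r: "r > 0" "r \<in> I" using p I(2) by (auto simp: r_def)
  have W: "W > 0" "W\<^sup>2 = 1 + m\<^sup>2" unfolding W_def by (auto intro: add_pos_nonneg)
  define X where "X = revolve l"
  note d = dir_deriv_revolve[OF I(1) _ l, folded X_def]
  have d1: "d1 X p = cyl (\<lambda>_. 1) (\<lambda>_. 0) l' p" and
    d2: "d2 X p = cyl (\<lambda>_. 0) (\<lambda>\<rho>. \<rho>) (\<lambda>_. 0) p" using d p by auto
  have d11: "d1 (d1 X) p = cyl (\<lambda>_. 0) (\<lambda>_. 0) l'' p"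
    by (rule dir_deriv_cyl(1)[OF I(1) p d(1) DERIV_const DERIV_const l'])
  have d12: "d1 (d2 X) p = cyl (\<lambda>_. 0) (\<lambda>_. 1) (\<lambda>_. 0) p"
    by (rule dir_deriv_cyl(1)[OF I(1) p d(2) DERIV_const DERIV_ident DERIV_const])
  have d22: "d2 (d2 X) p = cyl (\<lambda>\<rho>. - \<rho>) (\<lambda>_. 0) (\<lambda>_. 0) p"
    by (rule dir_deriv_cyl(2)[OF I(1) p d(2) DERIV_const DERIV_ident DERIV_const])
  define n0 where "n0 = cross3 (d1 X p) (d2 X p)"
  have n0: "n0 = cyl (\<lambda>x. - (l' x * x)) (\<lambda>_. 0) (\<lambda>x. x) p"
    by (simp add: n0_def d1 d2 cross_cyl)
  have "n0 \<bullet> n0 = (r * W)\<^sup>2"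
    unfolding n0 inner_cyl power_mult_distrib W(2)
    by (simp add: r_def[symmetric] m_def power2_eq_square algebra_simps)
  then have norm: "norm n0 = r * W" using r W by (simp add: norm_eq_sqrt_inner)
  have N: "unit_normal X p = (1 / (r * W)) *\<^sub>R n0"
    unfolding unit_normal_def n0_def[symmetric] sgn_div_norm norm by (simp add: divide_inverse)
  have E: "d1 X p \<bullet> d1 X p = W\<^sup>2" unfolding d1 inner_cyl W(2)
    by (simp add: m_def r_def power2_eq_square)
  have F: "d1 X p \<bullet> d2 X p = 0" by (simp add: d1 d2 inner_cyl)
  have G: "d2 X p \<bullet> d2 X p = r\<^sup>2" by (simp add: d2 inner_cyl r_def power2_eq_square)
  have e: "d1 (d1 X) p \<bullet> unit_normal X p = n / W"
    using r W by (simp add: N n0 d11 inner_cyl r_def[symmetric] n_def)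
  have f: "d1 (d2 X) p \<bullet> unit_normal X p = 0"
    by (simp add: N n0 d12 inner_cyl)
  have g: "d2 (d2 X) p \<bullet> unit_normal X p = r * m / W"
    using r W by (simp add: N n0 d22 inner_cyl r_def[symmetric] m_def)
  have H: "mean_curvature X p = (n / W ^ 3 + m / (r * W)) / 2"
    unfolding mean_curvature_def Let_def E F G e f g
    using r W(1) by (simp add: field_simps power2_eq_square power3_eq_cube)
  have K: "gauss_curvature X p = n / W ^ 3 * (m / (r * W))"
    unfolding gauss_curvature_def Let_def E F G e f g
    using r W(1) by (simp add: field_simps power2_eq_square power3_eq_cube)
  have "((\<lambda>x. l' x / (x * sqrt (1 + (l' x)\<^sup>2))) has_real_derivative
      (n * (r * W) - m * (W + r * (m * n / W))) / (r * W)\<^sup>2) (at r)"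
    using r W(1) unfolding W_def m_def n_def
    by (auto intro!: derivative_eq_intros l' simp: field_simps power2_eq_square)
  then have "k' = (n * (r * W) - m * (W + r * (m * n / W))) / (r * W)\<^sup>2"
    using k DERIV_unique unfolding r_def by blast
  also have "\<dots> = (r * n * (W\<^sup>2 - m\<^sup>2) / W - m * W) / (r * W)\<^sup>2"
    using r W(1) by (simp add: field_simps power2_eq_square)
  also have "W\<^sup>2 - m\<^sup>2 = 1" by (simp add: W(2))
  finally have "r * k' = n / W ^ 3 - m / (r * W)"
    using r W(1) by (simp add: field_simps power2_eq_square power3_eq_cube)
  moreover have "((x + y) / 2)\<^sup>2 - x * y = ((x - y) / 2)\<^sup>2" for x y :: real
    by (simp add: field_simps power2_eq_square)
  ultimately have "(mean_curvature X p)\<^sup>2 - gauss_curvature X p = (r * k' / 2)\<^sup>2"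
    unfolding H K by (simp only:)
  then show ?thesis
    by (simp add: geometric_potential_def X_def[symmetric] r_def[symmetric] abs_mult)
qed

lemma infdist_revolve:
  assumes "fst p \<ge> 0"
  shows "infdist (revolve l p) (range (\<lambda>t. t *\<^sub>R w)) = fst p"
proof -
  have axis: "t *\<^sub>R w = cyl (\<lambda>_. 0) (\<lambda>_. 0) (\<lambda>_. t) p" for t
    by (simp add: cyl_def case_prod_beta)
  have "revolve l p - t *\<^sub>R w = cyl (\<lambda>x. x) (\<lambda>_. 0) (\<lambda>x. l x - t) p" for t
    by (simp add: revolve_def cyl_def case_prod_beta algebra_simps)
  then have dist: "dist (revolve l p) (t *\<^sub>R w) = sqrt ((fst p)\<^sup>2 + (l (fst p) - t)\<^sup>2)" for t
    by (simp add: dist_norm norm_eq_sqrt_inner inner_cyl power2_eq_square)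
  show ?thesis
  proof (rule antisym)
    show "infdist (revolve l p) (range (\<lambda>t. t *\<^sub>R w)) \<le> fst p"
      using infdist_le[OF rangeI[of "\<lambda>t. t *\<^sub>R w" "l (fst p)"], of "revolve l p"] assms
      by (simp add: dist)
    have "fst p \<le> dist (revolve l p) (t *\<^sub>R w)" for t
      unfolding dist by (rule real_le_rsqrt) simp
    then show "fst p \<le> infdist (revolve l p) (range (\<lambda>t. t *\<^sub>R w))"
      by (auto simp: infdist_def intro!: cINF_greatest)
  qed
qed

end

section \<open>The generating family\<close>

text \<open>The sign \<open>\<epsilon>\<close> is the product of the two signs in the definition of the family; it disappears
  in the potential, where only \<open>\<bar>k'\<bar>\<close> enters.\<close>

lemma generating_family_parallel_curvature:
  assumes I: "open I" "I \<subseteq> {0<..}" and U: "smooth_on I U"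
    and lam: "lam \<in> generating_family U I a1 a2"
  obtains l' l'' \<epsilon> where "smooth_on I lam"
    "\<And>x. x \<in> I \<Longrightarrow> (lam has_real_derivative l' x) (at x)"
    "\<And>x. x \<in> I \<Longrightarrow> (l' has_real_derivative l'' x) (at x)"
    "\<bar>\<epsilon>\<bar> = 1"
    "\<And>x. x \<in> I \<Longrightarrow>
      ((\<lambda>x. l' x / (x * sqrt (1 + (l' x)\<^sup>2))) has_real_derivative 2 * \<epsilon> * U x / x) (at x)"
proof -
  from lam obtain s t A F G where st: "s \<in> {1, -1}" "t \<in> {1, -1}"
    and F: "antiderivative_on I (\<lambda>\<rho>. U \<rho> / \<rho>) F"
    and A: "\<And>\<rho>. \<rho> \<in> I \<Longrightarrow> A \<rho> = s * (2 * F \<rho> + a1)"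
    and pos: "\<And>\<rho>. \<rho> \<in> I \<Longrightarrow> 1 - \<rho>\<^sup>2 * (A \<rho>)\<^sup>2 > 0"
    and G: "antiderivative_on I (\<lambda>\<rho>. \<rho> * A \<rho> / sqrt (1 - \<rho>\<^sup>2 * (A \<rho>)\<^sup>2)) G"
    and lam: "\<And>\<rho>. \<rho> \<in> I \<Longrightarrow> lam \<rho> = t * G \<rho> + a2"
    unfolding generating_family_def by blast
  define W where "W = (\<lambda>x. 1 / sqrt (1 - x\<^sup>2 * (A x)\<^sup>2))"
  have I0: "x > 0" if "x \<in> I" for x using that I(2) by auto
  have dA: "(A has_real_derivative 2 * s * U x * inverse x) (at x)" if "x \<in> I" for x
  proof (rule has_field_derivative_transform_within_open[OF _ I(1) that])
    show "((\<lambda>x. s * (2 * F x + a1)) has_real_derivative 2 * s * U x * inverse x) (at x)"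
      using F that unfolding antiderivative_on_def
      by (auto intro!: derivative_eq_intros simp: field_simps)
  qed (simp add: A)
  have dlam: "(lam has_real_derivative t * (x * (A x * W x))) (at x)" if "x \<in> I" for x
  proof (rule has_field_derivative_transform_within_open[OF _ I(1) that])
    show "((\<lambda>x. t * G x + a2) has_real_derivative t * (x * (A x * W x))) (at x)"
      using G that unfolding antiderivative_on_def W_def
      by (auto intro!: derivative_eq_intros simp: field_simps)
  qed (simp add: lam)
  have dW: "(W has_real_derivative (W x * (W x * W x)) *
      (x * (A x * A x) + x * (x * (A x * (2 * s * U x * inverse x))))) (at x)" if "x \<in> I" for x
  proof -
    define h where "h = (\<lambda>x. 1 - x\<^sup>2 * (A x)\<^sup>2)"
    define A' where "A' = 2 * s * U x * inverse x"
    have A': "(A has_real_derivative A') (at x)" using dA[OF that] by (simp only: A'_def)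
    have h: "(h has_real_derivative - (2 * x * (A x)\<^sup>2 + x\<^sup>2 * (2 * A x * A'))) (at x)"
      unfolding h_def by (rule derivative_eq_intros refl A')+ (simp add: algebra_simps)
    have hx: "h x > 0" using pos[OF that] by (simp add: h_def)
    have "((\<lambda>y. 1 / sqrt y) has_real_derivative
        - ((1 / sqrt (h x)) ^ 3 / 2)) (at (h x))"
      using hx by (auto intro!: derivative_eq_intros
          simp: divide_simps power3_eq_cube power2_eq_square)
    from DERIV_chain2[OF this h] have "(W has_real_derivative - ((W x) ^ 3 / 2)
        * (- (2 * x * (A x)\<^sup>2 + x\<^sup>2 * (2 * A x * A')))) (at x)"
      unfolding W_def h_def .
    then show ?thesis
      by (rule back_subst[of "\<lambda>D. (W has_real_derivative D) (at x)"])
        (simp add: A'_def power3_eq_cube power2_eq_square algebra_simps)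
  qed
  \<comment> \<open>With \<open>inverse\<close> and the identity adjoined, the formulas above express the derivatives of
    \<open>A\<close>, \<open>W\<close> and \<open>lam\<close> as polynomials in the generators, which makes \<open>lam\<close> smooth.\<close>
  let ?Alg = "algebra_generated_by ({A, W, lam, inverse, \<lambda>x. x} \<union> {g. smooth_on I g})"
  note alg = algebra_generated_by.mult algebra_generated_by.add algebra_generated_by.const
    algebra_generated_by.gen
  have "smooth_on I lam"
  proof (rule differential_algebra_imp_smooth_on[OF I(1)])
    show "lam \<in> ?Alg" by (auto intro: alg(4))
    have mem: "A \<in> ?Alg" "W \<in> ?Alg" "inverse \<in> ?Alg" "(\<lambda>x. x) \<in> ?Alg" "U \<in> ?Alg"
      using U by (auto intro: alg(4))
    fix g assume "g \<in> {A, W, lam, inverse, \<lambda>x. x} \<union> {g. smooth_on I g}"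
    then consider "g = A" | "g = W" | "g = lam" | "g = inverse" | "g = (\<lambda>x. x)" | "smooth_on I g"
      by blast
    then show "\<exists>g'\<in>?Alg. \<forall>x\<in>I. (g has_real_derivative g' x) (at x)"
    proof cases
      case 1
      have "(\<lambda>x. 2 * s * U x * inverse x) \<in> ?Alg" by (intro alg(1-3) mem)
      then show ?thesis unfolding 1 by (rule bexI[rotated]) (intro ballI dA)
    next
      case 2
      have "(\<lambda>x. (W x * (W x * W x)) *
        (x * (A x * A x) + x * (x * (A x * (2 * s * U x * inverse x))))) \<in> ?Alg"
        by (intro alg(1-3) mem)
      then show ?thesis unfolding 2 by (rule bexI[rotated]) (intro ballI dW)
    next
      case 3
      have "(\<lambda>x. t * (x * (A x * W x))) \<in> ?Alg"
        by (intro alg(1-3) mem)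
      then show ?thesis unfolding 3 by (rule bexI[rotated]) (intro ballI dlam)
    next
      case 4
      have "(\<lambda>x. (- 1) * (inverse x * inverse x)) \<in> ?Alg"
        by (intro alg(1-3) mem)
      then show ?thesis unfolding 4
      proof (rule bexI[rotated], intro ballI)
        fix x assume "x \<in> I"
        then show "(inverse has_real_derivative (- 1) * (inverse x * inverse x)) (at x)"
          using I0[of x] DERIV_inverse[of x] by (simp add: power2_eq_square)
      qed
    next
      case 5
      then show ?thesis
        by (intro bexI[of _ "\<lambda>x. 1"]) (auto intro: algebra_generated_by.const)
    next
      case 6
      then obtain g' where g': "smooth_on I g'"
        "\<And>x. x \<in> I \<Longrightarrow> (g has_real_derivative g' x) (at x)"
        using smooth_on_imp_smooth_derivative by blast
      show ?thesis
        by (rule bexI[of _ g']) (use g' in \<open>auto intro: alg(4)\<close>)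
    qed
  qed
  then obtain l' where l': "smooth_on I l'" "\<And>x. x \<in> I \<Longrightarrow> (lam has_real_derivative l' x) (at x)"
    using smooth_on_imp_smooth_derivative by blast
  then obtain l'' where l'': "\<And>x. x \<in> I \<Longrightarrow> (l' has_real_derivative l'' x) (at x)"
    using smooth_on_imp_smooth_derivative by blast
  have k: "t * A x = l' x / (x * sqrt (1 + (l' x)\<^sup>2))" if "x \<in> I" for x
  proof -
    have t2: "t * t = 1" using st(2) by auto
    have l: "l' x = t * (x * (A x * W x))" using DERIV_unique[OF l'(2)[OF that] dlam[OF that]] .
    have W: "W x > 0" and W2: "(W x)\<^sup>2 * (1 - x\<^sup>2 * (A x)\<^sup>2) = 1"
      using pos[OF that] by (simp_all add: W_def power_divide)
    have "1 + (l' x)\<^sup>2 = 1 + (t * t) * (W x)\<^sup>2 * (x\<^sup>2 * (A x)\<^sup>2)"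
      unfolding l by (simp add: power2_eq_square)
    also have "\<dots> = (W x)\<^sup>2" using W2 t2 by (simp add: algebra_simps)
    finally have "sqrt (1 + (l' x)\<^sup>2) = W x" using W by simp
    then show ?thesis unfolding l using W I0[OF that] by simp
  qed
  have dk: "((\<lambda>x. l' x / (x * sqrt (1 + (l' x)\<^sup>2))) has_real_derivative
      2 * (s * t) * U x / x) (at x)" if "x \<in> I" for x
  proof (rule has_field_derivative_transform_within_open[OF _ I(1) that k])
    show "((\<lambda>x. t * A x) has_real_derivative 2 * (s * t) * U x / x) (at x)"
      using DERIV_cmult[OF dA[OF that], of t] by (simp add: field_simps)
  qed
  show ?thesis
    by (rule that[OF \<open>smooth_on I lam\<close> l'(2) l'' _ dk]) (use st in auto)
qed

lemma (in oriented_frame) generating_family_revolve: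
  assumes I: "open I" "I \<subseteq> {0<..}" and U: "smooth_on I U"
    and lam: "lam \<in> generating_family U I a1 a2"
  shows "regular_surface_on (I \<times> UNIV) (revolve lam)"
    and "\<forall>p \<in> I \<times> UNIV. geometric_potential (revolve lam) p
        = \<bar>U (infdist (revolve lam p) (range (\<lambda>t. t *\<^sub>R w)))\<bar>"
proof -
  from generating_family_parallel_curvature[OF assms] obtain l' l'' \<epsilon> where l: "smooth_on I lam"
    "\<And>x. x \<in> I \<Longrightarrow> (lam has_real_derivative l' x) (at x)"
    "\<And>x. x \<in> I \<Longrightarrow> (l' has_real_derivative l'' x) (at x)"
    and eps: "\<bar>\<epsilon>\<bar> = 1"
    and k: "\<And>x. x \<in> I \<Longrightarrow>
      ((\<lambda>x. l' x / (x * sqrt (1 + (l' x)\<^sup>2))) has_real_derivative 2 * \<epsilon> * U x / x) (at x)"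
    by blast
  show "regular_surface_on (I \<times> UNIV) (revolve lam)"
    by (rule regular_surface_revolve[OF I l(1)])
  show "\<forall>p \<in> I \<times> UNIV. geometric_potential (revolve lam) p
      = \<bar>U (infdist (revolve lam p) (range (\<lambda>t. t *\<^sub>R w)))\<bar>"
  proof
    fix p :: "real \<times> real" assume p: "p \<in> I \<times> UNIV"
    then have r: "fst p \<in> I" "fst p > 0" using I(2) by auto
    have "geometric_potential (revolve lam) p = \<bar>fst p * (2 * \<epsilon> * U (fst p) / fst p)\<bar> / 2"
      by (rule geometric_potential_revolve[OF I p l(2,3) k[OF r(1)]])
    also have "\<dots> = \<bar>U (fst p)\<bar>" using r eps by (simp add: abs_mult)
    finally show "geometric_potential (revolve lam) p
        = \<bar>U (infdist (revolve lam p) (range (\<lambda>t. t *\<^sub>R w)))\<bar>"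
      using r by (simp add: infdist_revolve)
  qed
qed

theorem proposition9p4p1:
  fixes U lam :: "real \<Rightarrow> real" and I :: "real set" and a1 a2 :: real
  assumes "open I" and "is_interval I" and "I \<subseteq> {0<..}"
    and "smooth_on I U"
    and "lam \<in> generating_family U I a1 a2"
  shows "regular_surface_on (I \<times> UNIV) (revolve_z lam) \<and>
         (\<forall>p \<in> I \<times> UNIV.
            geometric_potential (revolve_z lam) p = \<bar>U (infdist (revolve_z lam p) z_axis)\<bar>) \<and>
         regular_surface_on (I \<times> UNIV) (revolve_x lam) \<and>
         (\<forall>p \<in> I \<times> UNIV.
            geometric_potential (revolve_x lam) p = \<bar>U (infdist (revolve_x lam p) x_axis)\<bar>)"
proof -
  \<comment> \<open>The frames are read off from the position at angle \<open>0\<close> and a quarter turn later.  For the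
    rotation around \<open>x\<close> the radial direction is \<open>z\<close> at first, and it turns towards \<open>- y\<close>.\<close>
  interpret z: oriented_frame "axis 1 1" "axis 2 1" "axis 3 1"
    by unfold_locales (simp_all add: cross_basis inner_axis_axis)
  interpret x: oriented_frame "axis 3 1" "- axis 2 1" "axis 1 1"
    by unfold_locales (simp_all add: cross_basis inner_axis_axis)
  have "revolve_z lam = z.revolve lam"
    unfolding revolve_z_def z.revolve_def z.cyl_def z.radial_def rot_z_def
    by (auto simp: fun_eq_iff vec_eq_iff forall_3 axis_def)
  moreover have "revolve_x lam = x.revolve lam"
    unfolding revolve_x_def x.revolve_def x.cyl_def x.radial_def rot_x_def
    by (auto simp: fun_eq_iff vec_eq_iff forall_3 axis_def)
  moreover have "z_axis = range (\<lambda>t. t *\<^sub>R axis 3 1)" "x_axis = range (\<lambda>t. t *\<^sub>R axis 1 1)"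
    unfolding z_axis_def x_axis_def
    by (auto intro!: arg_cong[where f = range] simp: fun_eq_iff vec_eq_iff forall_3 axis_def)
  ultimately show ?thesis
    using z.generating_family_revolve[OF assms(1,3-5)] x.generating_family_revolve[OF assms(1,3-5)]
    by simp
qed

end
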